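(* Let $n\ge2$, $\lambda=\frac{n-1}2$ and $d\in\mathbb N$. The Euclidean limit $G^{[d]}$ of the directional Poisson wavelets $g_\rho^{[d]}$ of order $d$ on $\mathcal S^n$ exists and is given by $$ G^{[d]}(\xi)=\frac{\partial^d}{\partial\xi_2^d}\,\frac{2}{\Sigma_n(1+|\xi|^2)^{\lambda+1}},\qquad \xi=(\xi_2,\xi_3,\dots,\xi_{n+1})\in\mathbb R^n. $$
   Context: $\mathcal S^n\subset\mathbb R^{n+1}$ is the unit sphere with total surface measure $\Sigma_n=\frac{2\pi^{(n+1)/2}}{\Gamma((n+1)/2)}$, and $\widehat e=(1,0,\dots,0)$ is its north pole. The Poisson kernel located at $\zeta=r\widehat e$, $0<r<1$, is $p_\zeta(x)=\frac1{\Sigma_n}\frac{1-r^2}{(1-2r\,x_1+r^2)^{(n+1)/2}}$, $x\in\mathcal S^n$. $\Upsilon_\Theta$ is the rotation of $\mathbb R^{n+1}$ mapping $(x_1,x_2,x_3,\dots)$ to $(x_1\cos\Theta-x_2\sin\Theta,\;x_1\sin\Theta+x_2\cos\Theta,\;x_3,\dots)$. The directional Poisson (multipole) wavelet of order $d\in\mathbb N$ at scale $\rho>0$ is $$ g_\rho^{[d]}(x)=\rho^d\left.\frac{\partial^d}{\partial\Theta^d}\,p_\zeta(\Upsilon_\Theta x)\right|_{\Theta=0},\qquad\zeta=e^{-\rho}\widehat e. $$ $S$ is the stereographic projection from the south pole $-\widehat e$ onto the tangent space at $\widehat e$ (identified with $\mathbb R^n$ with coordinates indexed $2,\dots,n+1$);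 explicitly $S^{-1}(y)=\left(\frac{4-|y|^2}{4+|y|^2},\frac{4y}{4+|y|^2}\right)$, so that the polar angle of $S^{-1}(y)$ is $\theta_1=2\arctan\frac{|y|}2$. The Euclidean limit of $\{g_\rho^{[d]}\}_{\rho>0}$ is the square integrable function $G^{[d]}:\mathbb R^n\to\mathbb C$ such that $\lim_{\rho\to0}\rho^n g_\rho^{[d]}\left(S^{-1}(\rho\xi)\right)=G^{[d]}(\xi)$ point-wise for every $\xi\in\mathbb R^n$. *)

theory Defs
  imports "HOL-Analysis.Analysis"
begin

text \<open>
  The space \<open>\<real>\<^sup>n\<close> is \<^typ>\<open>real^'n\<close> with \<open>n = CARD('n)\<close>, and \<open>\<real>\<^sup>n\<^sup>+\<^sup>1\<close> is \<^typ>\<open>real \<times> (real^'n)\<close>, whose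
  library norm is the Euclidean one. The first component is the coordinate \<open>x\<^sub>1\<close>; the
  coordinates \<open>x\<^sub>2, \<dots>, x\<^sub>n\<^sub>+\<^sub>1\<close> are indexed by the type \<open>'n\<close>, and the parameter \<open>k :: 'n\<close> below
  is the index carrying the label 2. The sphere is \<open>sphere 0 1\<close>, its north pole \<open>(1, 0)\<close>.
\<close>

definition sphere_area :: "nat \<Rightarrow> real" where
  "sphere_area n = 2 * pi powr ((real n + 1) / 2) / Gamma ((real n + 1) / 2)"

text \<open>The kernel located at \<open>r\<close> times the north pole, for \<open>0 < r < 1\<close>.\<close>

definition poisson_kernel :: "real \<Rightarrow> real \<times> (real^'n) \<Rightarrow> real" where
  "poisson_kernel r x =
     1 / sphere_area CARD('n) *
     ((1 - r\<^sup>2) / (1 - 2 * r * fst x + r\<^sup>2) powr ((real CARD('n) + 1) / 2))"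

definition rotation :: "'n \<Rightarrow> real \<Rightarrow> real \<times> (real^'n) \<Rightarrow> real \<times> (real^'n)" where
  "rotation k \<Theta> x =
     (fst x * cos \<Theta> - snd x $ k * sin \<Theta>,
      \<chi> i. if i = k then fst x * sin \<Theta> + snd x $ k * cos \<Theta> else snd x $ i)"

definition poisson_wavelet :: "'n \<Rightarrow> nat \<Rightarrow> real \<Rightarrow> real \<times> (real^'n) \<Rightarrow> real" where
  "poisson_wavelet k d \<rho> x =
     \<rho> ^ d * (deriv ^^ d) (\<lambda>\<Theta>. poisson_kernel (exp (- \<rho>)) (rotation k \<Theta> x)) 0"

definition stereographic_inv :: "real^'n \<Rightarrow> real \<times> (real^'n)" where
  "stereographic_inv y =
     ((4 - (norm y)\<^sup>2) / (4 + (norm y)\<^sup>2), (4 / (4 + (norm y)\<^sup>2)) *\<^sub>R y)"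

text \<open>
  The next two facts say that \<open>stereographic_inv y\<close> is the point of the sphere on the line
  through the south pole \<open>(-1, 0)\<close> and the point \<open>(1, y)\<close> of the tangent space at the north pole.
\<close>

lemma stereographic_inv_in_sphere: "stereographic_inv y \<in> sphere 0 1"
proof -
  have pos: "4 + (norm y)\<^sup>2 > 0"
    by (simp add: add_pos_nonneg)
  have "((4 - (norm y)\<^sup>2) / (4 + (norm y)\<^sup>2))\<^sup>2 + (4 / (4 + (norm y)\<^sup>2) * norm y)\<^sup>2
      = ((4 - (norm y)\<^sup>2)\<^sup>2 + 16 * (norm y)\<^sup>2) / (4 + (norm y)\<^sup>2)\<^sup>2"
    by (simp add: power_divide power_mult_distrib add_divide_distrib)
  also have "(4 - (norm y)\<^sup>2)\<^sup>2 + 16 * (norm y)\<^sup>2 = (4 + (norm y)\<^sup>2)\<^sup>2"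
    by (simp add: power2_eq_square algebra_simps)
  finally show ?thesis
    using pos by (simp add: stereographic_inv_def norm_Pair power_divide)
qed

lemma stereographic_inv_on_line:
  "stereographic_inv y = (-1, 0) + (4 / (4 + (norm y)\<^sup>2)) *\<^sub>R ((1, y) - (-1, 0))"
proof -
  have "4 + (norm y)\<^sup>2 \<noteq> 0"
    by (smt (verit) zero_le_power2)
  then show ?thesis
    by (simp add: stereographic_inv_def field_simps)
qed

definition square_integrable :: "(real^'n \<Rightarrow> complex) \<Rightarrow> bool" where
  "square_integrable G \<longleftrightarrow>
     G \<in> borel_measurable lebesgue \<and> integrable lebesgue (\<lambda>\<xi>. (norm (G \<xi>))\<^sup>2)"

definition has_euclidean_limit ::
  "(real \<Rightarrow> real \<times> (real^'n) \<Rightarrow> complex) \<Rightarrow> (real^'n \<Rightarrow> complex) \<Rightarrow> bool" where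
  "has_euclidean_limit g G \<longleftrightarrow>
     square_integrable G \<and>
     (\<forall>\<xi>. ((\<lambda>\<rho>. of_real (\<rho> ^ CARD('n)) * g \<rho> (stereographic_inv (\<rho> *\<^sub>R \<xi>))) \<longlongrightarrow> G \<xi>)
           (at_right 0))"

lemma has_euclidean_limit_unique:
  assumes "has_euclidean_limit g G" "has_euclidean_limit g H"
  shows "G = H"
proof
  fix \<xi>
  show "G \<xi> = H \<xi>"
    using assms unfolding has_euclidean_limit_def
    by (blast intro: tendsto_unique[OF trivial_limit_at_right_real])
qed

definition partial_deriv :: "'n \<Rightarrow> (real^'n \<Rightarrow> real) \<Rightarrow> real^'n \<Rightarrow> real" where
  "partial_deriv k F \<xi> = deriv (\<lambda>t. F (\<xi> + t *\<^sub>R axis k 1)) 0"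

end

theory Submission
  imports Defs "HOL-Complex_Analysis.Cauchy_Integral_Formula"
begin

text \<open>
  Why the limit exists. Substitute \<open>\<Theta> = \<rho> t\<close>, so that \<open>\<rho>\<^sup>d\<close> times the \<open>d\<close>-th derivative in \<open>\<Theta>\<close> becomes the
  \<open>d\<close>-th derivative in \<open>t\<close>. At the point \<open>x = S\<^sup>-\<^sup>1(\<rho> \<xi>)\<close> the denominator of the rotated kernel satisfies
  \<open>1 - 2 r (x\<^sub>1 cos(\<rho> t) - x\<^sub>2 sin(\<rho> t)) + r\<^sup>2 = \<rho>\<^sup>2 (1 + |\<xi> + t e\<^sub>2|\<^sup>2 + o(1))\<close> with \<open>r = exp(-\<rho>)\<close>,
  because rotating by \<open>\<rho> t\<close> is, to first order, a translation by \<open>\<rho> t\<close> in the tangent space. The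
  denominator occurs with exponent \<open>a = (n + 1) / 2 = \<lambda> + 1\<close>, hence contributes \<open>\<rho>\<^sup>-\<^sup>n\<^sup>-\<^sup>1\<close>; together with
  \<open>1 - r\<^sup>2 \<sim> 2 \<rho>\<close> and the factor \<open>\<rho>\<^sup>n\<close> this leaves \<open>2 / \<Sigma>\<^sub>n\<close> times \<open>(1 + |\<xi> + t e\<^sub>2|\<^sup>2)\<^sup>-\<^sup>a\<close>.

  Why the limit commutes with the derivatives. Everything extends holomorphically to complex \<open>t = w\<close>
  with \<open>|w| \<le> 1/2\<close>: on this disc the limit denominator has real part at least \<open>(1 + |\<xi>|\<^sup>2) / 4\<close>
  (\<open>Re_limit_denom_ge\<close>), so the principal branch of the power is available for it and, for small \<open>\<rho>\<close>,
  for the rescaled denominators. The convergence is uniform on the disc, and locally uniform limits of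
  holomorphic functions may be differentiated (\<open>higher_deriv_rescaled_tendsto\<close>). The real derivatives
  are recovered from the complex ones by \<open>higher_deriv_real_of_holomorphic\<close>.

  Why the limit is square integrable. Cauchy's estimate on the same disc, whose radius does not depend
  on \<open>\<xi>\<close>, bounds the \<open>d\<close>-th derivative by a constant times \<open>(1 + |\<xi>|\<^sup>2)\<^sup>-\<^sup>a\<close> (\<open>higher_deriv_limit_bound\<close>),
  and the square \<open>(1 + |\<xi>|\<^sup>2)\<^sup>-\<^sup>n\<^sup>-\<^sup>1\<close> of this is integrable over \<open>\<real>\<^sup>n\<close>.
\<close>

section \<open>Real derivatives and holomorphic extensions\<close>

text \<open>
  If a real function agrees on the real axis with a multiple of a rescaled holomorphic function, so do all of
  its derivatives. In each step the complex derivative along the real axis is the derivative of a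
  real-valued function, so it is real and equals the real derivative. The rescaling \<open>c\<close> serves for the
  passage from the angle \<open>\<Theta>\<close> to \<open>\<Theta> / \<rho>\<close>.
\<close>

lemma higher_deriv_real_of_holomorphic:
  fixes g :: "complex \<Rightarrow> complex" and h :: "real \<Rightarrow> real" and c :: real and K :: complex
  assumes g: "g holomorphic_on S" and S: "open S"
    and h: "\<And>t. of_real (c * t) \<in> S \<Longrightarrow> of_real (h t) = K * g (of_real (c * t))"
    and t: "of_real (c * t) \<in> S"
  shows "of_real ((deriv ^^ d) h t) = K * of_real c ^ d * (deriv ^^ d) g (of_real (c * t))"
    and "(deriv ^^ d) h field_differentiable at t"
proof -
  let ?T = "{t. complex_of_real (c * t) \<in> S}"
  have "open ((\<lambda>t. complex_of_real (c * t)) -` S)"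
    by (intro open_vimage[OF S] continuous_intros)
  then have T: "open ?T" by (simp add: vimage_def)
  have step: "((deriv ^^ d) h has_field_derivative Re (K * of_real c ^ Suc d * (deriv ^^ Suc d) g (of_real (c * t)))) (at t)
      \<and> K * of_real c ^ Suc d * (deriv ^^ Suc d) g (of_real (c * t)) \<in> \<real>"
    if eq: "\<And>t. t \<in> ?T \<Longrightarrow> of_real ((deriv ^^ d) h t) = K * of_real c ^ d * (deriv ^^ d) g (of_real (c * t))"
      and t: "t \<in> ?T" for d t
  proof -
    let ?D = "K * of_real c ^ Suc d * (deriv ^^ Suc d) g (of_real (c * t))"
    have "((deriv ^^ d) g has_field_derivative (deriv ^^ Suc d) g (of_real (c * t))) (at (of_real (c * t)))"
      using holomorphic_derivI[OF holomorphic_higher_deriv[OF g S, of d] S] t by simp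
    then have "((\<lambda>z. K * of_real c ^ d * (deriv ^^ d) g (of_real c * z)) has_field_derivative ?D) (at (of_real t))"
      by (auto intro!: derivative_eq_intros DERIV_chain2[of "(deriv ^^ d) g"])
    from has_vector_derivative_real_field[OF this]
    have "((\<lambda>t. K * of_real c ^ d * (deriv ^^ d) g (of_real (c * t))) has_vector_derivative ?D) (at t)"
      by simp
    then have v: "((\<lambda>t. complex_of_real ((deriv ^^ d) h t)) has_vector_derivative ?D) (at t)"
      by (rule has_vector_derivative_transform_within_open[OF _ T t]) (use eq in simp)
    have "((\<lambda>t. 0) has_vector_derivative Im ?D) (at t)"
      using bounded_linear.has_vector_derivative[OF bounded_linear_Im v] by simp
    then have "Im ?D = 0"
      using has_vector_derivative_const vector_derivative_unique_at by blast
    moreover have "((deriv ^^ d) h has_vector_derivative Re ?D) (at t)"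
      using bounded_linear.has_vector_derivative[OF bounded_linear_Re v] by simp
    ultimately show ?thesis
      by (simp add: has_real_derivative_iff_has_vector_derivative complex_is_Real_iff)
  qed
  have main: "of_real ((deriv ^^ d) h t) = K * of_real c ^ d * (deriv ^^ d) g (of_real (c * t))"
    if "t \<in> ?T" for d t
    using that
  proof (induction d arbitrary: t)
    case 0
    then show ?case using h by simp
  next
    case (Suc d)
    let ?D = "K * of_real c ^ Suc d * (deriv ^^ Suc d) g (of_real (c * t))"
    have "(deriv ^^ Suc d) h t = Re ?D"
      using step[OF Suc.IH Suc.prems] DERIV_imp_deriv by (metis comp_apply funpow.simps(2))
    moreover have "of_real (Re ?D) = ?D"
      using step[OF Suc.IH Suc.prems] of_real_Re by blast
    ultimately show ?case
      by (simp only:)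
  qed
  show "of_real ((deriv ^^ d) h t) = K * of_real c ^ d * (deriv ^^ d) g (of_real (c * t))"
    using main t by simp
  show "(deriv ^^ d) h field_differentiable at t"
    using step[OF main] t unfolding field_differentiable_def by blast
qed

lemma partial_deriv_iterate_line:
  "(partial_deriv k ^^ d) F (\<xi> + t *\<^sub>R axis k 1) = (deriv ^^ d) (\<lambda>s. F (\<xi> + s *\<^sub>R axis k 1)) t"
proof (induction d arbitrary: t)
  case (Suc d)
  have "(partial_deriv k ^^ Suc d) F (\<xi> + t *\<^sub>R axis k 1)
      = deriv (\<lambda>s. (partial_deriv k ^^ d) F (\<xi> + (t + s) *\<^sub>R axis k 1)) 0"
    by (simp add: partial_deriv_def algebra_simps)
  also have "\<dots> = deriv (\<lambda>s. (deriv ^^ d) (\<lambda>s. F (\<xi> + s *\<^sub>R axis k 1)) (t + s)) 0"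
    by (simp only: Suc.IH)
  also have "\<dots> = (deriv ^^ Suc d) (\<lambda>s. F (\<xi> + s *\<^sub>R axis k 1)) t"
    by (simp add: deriv_shift_0[of _ t] o_def)
  finally show ?case .
qed simp

text \<open>
  The partial derivative is the pointwise limit of the difference quotients with increments \<open>1 / (i + 1)\<close>, and
  each of these quotients inherits measurability from the function.
\<close>

lemma partial_deriv_measurable:
  fixes F :: "real^'n \<Rightarrow> real"
  assumes [measurable]: "F \<in> borel_measurable borel"
    and diff: "\<And>\<xi>. (\<lambda>t. F (\<xi> + t *\<^sub>R axis k 1)) field_differentiable at 0"
  shows "partial_deriv k F \<in> borel_measurable borel"
proof (rule borel_measurable_LIMSEQ_real)
  fix \<xi> :: "real^'n"
  have "((\<lambda>t. F (\<xi> + t *\<^sub>R axis k 1)) has_field_derivative partial_deriv k F \<xi>) (at 0)"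
    unfolding partial_deriv_def using diff field_differentiable_derivI by blast
  then have "((\<lambda>h. (F (\<xi> + h *\<^sub>R axis k 1) - F \<xi>) / h) \<longlongrightarrow> partial_deriv k F \<xi>) (at 0)"
    by (simp add: DERIV_def)
  moreover have "filterlim (\<lambda>i. inverse (real (Suc i))) (at 0) sequentially"
    unfolding filterlim_at using LIMSEQ_inverse_real_of_nat by simp
  ultimately show "(\<lambda>i. (F (\<xi> + inverse (real (Suc i)) *\<^sub>R axis k 1) - F \<xi>) / inverse (real (Suc i)))
      \<longlonglongrightarrow> partial_deriv k F \<xi>"
    by (rule filterlim_compose)
qed measurable

section \<open>Uniform limits on compact sets from joint limits\<close>

text \<open>
  Near each point of \<open>K\<close> the property holds for a filter-large set of parameters; finitely many of these
  neighbourhoods cover \<open>K\<close>.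
\<close>

lemma eventually_ball_compact:
  fixes K :: "'a::topological_space set"
  assumes "compact K"
    and ev: "\<And>w. w \<in> K \<Longrightarrow> \<forall>\<^sub>F (\<rho>, w) in F \<times>\<^sub>F nhds w. P \<rho> w"
  shows "\<forall>\<^sub>F \<rho> in F. \<forall>w\<in>K. P \<rho> w"
proof -
  have "\<exists>A U. open U \<and> w \<in> U \<and> eventually A F \<and> (\<forall>\<rho> v. A \<rho> \<longrightarrow> v \<in> U \<longrightarrow> P \<rho> v)" if "w \<in> K" for w
    using ev[OF that] unfolding eventually_prod_filter eventually_nhds
    by (smt (verit, best) case_prod_conv)
  then obtain A U where AU: "\<And>w. w \<in> K \<Longrightarrow> open (U w)" "\<And>w. w \<in> K \<Longrightarrow> w \<in> U w"
      "\<And>w. w \<in> K \<Longrightarrow> eventually (A w) F" "\<And>w \<rho> v. w \<in> K \<Longrightarrow> A w \<rho> \<Longrightarrow> v \<in> U w \<Longrightarrow> P \<rho> v"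
    by metis
  obtain C where C: "C \<subseteq> K" "finite C" "K \<subseteq> (\<Union>w\<in>C. U w)"
    using compactE_image[OF \<open>compact K\<close>, of K U] AU by blast
  have "\<forall>\<^sub>F \<rho> in F. \<forall>w\<in>C. A w \<rho>"
    using C AU(3) by (intro eventually_ball_finite) auto
  then show ?thesis
    by eventually_elim (use C AU(4) in blast)
qed

text \<open>
  Uniformity on a compact set follows from joint limits in the parameter and the point. Joint
  limits can be computed by the rules for sums, products and powers, which avoids
  uniform estimates for the composite expression.
\<close>

lemma uniform_limit_compact_joint:
  fixes f :: "'b \<Rightarrow> 'a::t2_space \<Rightarrow> 'c::metric_space"
  assumes "compact K"
    and lim: "\<And>w. w \<in> K \<Longrightarrow> ((\<lambda>(\<rho>, w). f \<rho> w) \<longlongrightarrow> l w) (F \<times>\<^sub>F nhds w)"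
    and cont: "\<And>w. w \<in> K \<Longrightarrow> isCont l w"
  shows "uniform_limit K f l F"
proof (rule uniform_limitI)
  fix e :: real assume "e > 0"
  show "\<forall>\<^sub>F \<rho> in F. \<forall>w\<in>K. dist (f \<rho> w) (l w) < e"
  proof (rule eventually_ball_compact[OF \<open>compact K\<close>])
    fix w assume "w \<in> K"
    have "((\<lambda>p. l (snd p)) \<longlongrightarrow> l w) (F \<times>\<^sub>F nhds w)"
      by (rule isCont_tendsto_compose[OF cont[OF \<open>w \<in> K\<close>] filterlim_snd])
    with lim[OF \<open>w \<in> K\<close>]
    have "((\<lambda>p. dist (case p of (\<rho>, w) \<Rightarrow> f \<rho> w) (l (snd p))) \<longlongrightarrow> dist (l w) (l w)) (F \<times>\<^sub>F nhds w)"
      by (rule tendsto_dist)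
    with \<open>e > 0\<close> have "\<forall>\<^sub>F p in F \<times>\<^sub>F nhds w. dist (case p of (\<rho>, w) \<Rightarrow> f \<rho> w) (l (snd p)) < e"
      by (intro order_tendstoD) auto
    then show "\<forall>\<^sub>F (\<rho>, w) in F \<times>\<^sub>F nhds w. dist (f \<rho> w) (l w) < e"
      by (simp add: case_prod_unfold)
  qed
qed

text \<open>
  The quotient is \<open>w\<close> times \<open>sin z / z\<close> at \<open>z = \<rho> w\<close>, and \<open>sin z / z\<close> extends continuously
  to \<open>z = 0\<close> with the value 1.
\<close>

lemma tendsto_sin_scaled:
  fixes w :: complex
  shows "((\<lambda>(\<rho>, w). sin (of_real \<rho> * w) / of_real \<rho>) \<longlongrightarrow> w) (at_right (0::real) \<times>\<^sub>F nhds w)"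
proof -
  define s where "s = (\<lambda>z::complex. if z = 0 then 1 else sin z / z)"
  let ?F = "at_right (0::real) \<times>\<^sub>F nhds w"
  have "(sin has_field_derivative 1) (at (0::complex))"
    by (auto intro!: derivative_eq_intros)
  then have "((\<lambda>z::complex. sin z / z) \<longlongrightarrow> 1) (at 0)"
    by (simp add: DERIV_def)
  then have s0: "isCont s 0"
    unfolding isCont_def s_def by (simp cong: LIM_cong)
  have fst: "(fst \<longlongrightarrow> 0) ?F" "\<forall>\<^sub>F p in ?F. fst p > 0"
    using filterlim_fst[of "at_right (0::real)" "nhds w"] unfolding filterlim_at by (auto elim: eventually_mono)
  have w: "(snd \<longlongrightarrow> w) ?F"
    by (rule filterlim_snd)
  have "((\<lambda>p. of_real (fst p) * snd p) \<longlongrightarrow> of_real 0 * w) ?F"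
    by (intro tendsto_mult tendsto_of_real fst w)
  then have "((\<lambda>p. s (of_real (fst p) * snd p)) \<longlongrightarrow> s 0) ?F"
    using isCont_tendsto_compose[OF s0] by simp
  from tendsto_mult[OF w this] have "((\<lambda>p. snd p * s (of_real (fst p) * snd p)) \<longlongrightarrow> w) ?F"
    by (simp add: s_def)
  then show ?thesis
    by (rule Lim_transform_eventually) (use fst(2) in \<open>auto elim!: eventually_mono simp: s_def\<close>)
qed

section \<open>An integrable function on Euclidean space\<close>

text \<open>
  Since \<open>1 + x\<^sub>b\<^sup>2 \<le> 1 + |x|\<^sup>2\<close> in each of the coordinates, the function is dominated by a
  product of one-dimensional functions \<open>1 / (1 + x\<^sub>b\<^sup>2)\<close>, whose integral factorizes.
\<close>

lemma integrable_one_plus_norm_powr: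
  assumes p: "p \<ge> real DIM('a::euclidean_space)"
  shows "integrable lborel (\<lambda>x::'a. (1 + (norm x)\<^sup>2) powr (- p))"
proof -
  let ?f = "\<lambda>x::'a. (1 + (norm x)\<^sup>2) powr (- p)"
  let ?q = "\<lambda>x::real. inverse (1 + x\<^sup>2)"
  have le: "?f x \<le> (\<Prod>b\<in>Basis. ?q (x \<bullet> b))" for x :: 'a
  proof -
    have "(\<Prod>b\<in>Basis. 1 + (x \<bullet> b)\<^sup>2) \<le> (\<Prod>b\<in>(Basis::'a set). 1 + (norm x)\<^sup>2)"
    proof (rule prod_mono, intro conjI)
      fix b :: 'a assume "b \<in> Basis"
      then have "(x \<bullet> b)\<^sup>2 \<le> (norm x)\<^sup>2"
        by (metis Basis_le_norm abs_le_square_iff abs_norm_cancel)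
      then show "1 + (x \<bullet> b)\<^sup>2 \<le> 1 + (norm x)\<^sup>2" by simp
    qed simp
    also have "\<dots> = (1 + (norm x)\<^sup>2) powr real DIM('a)"
      by (subst powr_realpow) (simp_all add: add_pos_nonneg)
    also have "\<dots> \<le> (1 + (norm x)\<^sup>2) powr p"
      using p by (intro powr_mono) auto
    finally have "(\<Prod>b\<in>Basis. 1 + (x \<bullet> b)\<^sup>2) \<le> (1 + (norm x)\<^sup>2) powr p" .
    moreover have "0 < (\<Prod>b\<in>Basis. 1 + (x \<bullet> b)\<^sup>2)"
      by (intro prod_pos) (simp add: add_pos_nonneg)
    moreover have "(\<Prod>b\<in>Basis. ?q (x \<bullet> b)) = inverse (\<Prod>b\<in>Basis. 1 + (x \<bullet> b)\<^sup>2)"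
      using prod_inversef[of "\<lambda>b. 1 + (x \<bullet> b)\<^sup>2" Basis] by (simp add: comp_def)
    ultimately show ?thesis
      by (simp only: powr_minus le_imp_inverse_le)
  qed
  have half: "(\<integral>\<^sup>+x. ennreal (?q x) * indicator {0..} x \<partial>lborel) = ennreal (pi / 2)"
    using nn_integral_FTC_atLeast[of ?q 0 arctan "pi / 2"] tendsto_arctan_at_top
    by (auto intro!: DERIV_arctan)
  have "(\<integral>\<^sup>+x. ennreal (?q x) * indicator {..0} x \<partial>lborel)
      = (\<integral>\<^sup>+x. ennreal (?q (0 + (-1) * x)) * indicator {..0} (0 + (-1) * x) \<partial>lborel)"
    by (subst nn_integral_real_affine[where c="-1" and t=0]) auto
  also have "\<dots> = ennreal (pi / 2)"
    unfolding half[symmetric] by (intro nn_integral_cong) (auto simp: indicator_def)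
  finally have half': "(\<integral>\<^sup>+x. ennreal (?q x) * indicator {..0} x \<partial>lborel) = ennreal (pi / 2)" .
  have "(\<integral>\<^sup>+x. ennreal (?q x) \<partial>lborel)
      \<le> (\<integral>\<^sup>+x. ennreal (?q x) * indicator {0..} x + ennreal (?q x) * indicator {..0} x \<partial>lborel)"
    by (intro nn_integral_mono) (auto simp: indicator_def)
  also have "\<dots> = ennreal (pi / 2) + ennreal (pi / 2)"
    by (subst nn_integral_add) (auto simp: half half')
  finally have one: "(\<integral>\<^sup>+x. ennreal (?q x) \<partial>lborel) < \<infinity>"
    by (simp add: le_less_trans ennreal_plus[symmetric] del: ennreal_plus)
  have "(\<integral>\<^sup>+x. ennreal (?f x) \<partial>lborel) \<le> (\<integral>\<^sup>+x. (\<Prod>b\<in>(Basis::'a set). ennreal (?q (x \<bullet> b))) \<partial>lborel)"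
    by (intro nn_integral_mono) (simp add: prod_ennreal ennreal_leI[OF le])
  also have "\<dots> = (\<Prod>b\<in>(Basis::'a set). (\<integral>\<^sup>+x. ennreal (?q x) \<partial>lborel))"
    by (rule nn_integral_lborel_prod) auto
  also have "\<dots> < \<infinity>"
    using one by (simp add: power_less_top_ennreal)
  finally show ?thesis
    by (intro integrableI_bounded) auto
qed

section \<open>The limit denominator\<close>

text \<open>
  The polynomial in \<open>w\<close> that extends \<open>1 + |\<xi> + t e\<^sub>k|\<^sup>2\<close> to complex \<open>t\<close>.
\<close>

definition limit_denom :: "'n \<Rightarrow> real^'n \<Rightarrow> complex \<Rightarrow> complex" where
  "limit_denom k \<xi> w = 1 + of_real ((norm \<xi>)\<^sup>2) + 2 * of_real (\<xi> $ k) * w + w\<^sup>2"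

lemma limit_denom_of_real:
  "limit_denom k \<xi> (of_real t) = of_real (1 + (norm (\<xi> + t *\<^sub>R axis k 1))\<^sup>2)"
proof -
  have "(norm (\<xi> + t *\<^sub>R axis k 1))\<^sup>2 = (norm \<xi>)\<^sup>2 + 2 * t * \<xi> $ k + t\<^sup>2"
    unfolding power2_norm_eq_inner
    by (simp add: inner_add_left inner_add_right inner_axis inner_axis' power2_eq_square inner_commute algebra_simps)
  then show ?thesis
    by (simp add: limit_denom_def algebra_simps)
qed

text \<open>
  On this disc the linear term is at most \<open>|\<xi>|\<close> and the quadratic one at most \<open>1/4\<close> in modulus, so it remains to check
  that \<open>1 + s\<^sup>2 - s - 1/4 \<ge> (1 + s\<^sup>2) / 4\<close> for \<open>s = |\<xi>|\<close>. The radius does not depend on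
  \<open>\<xi>\<close>, which is what makes Cauchy's estimate uniform in \<open>\<xi>\<close>.
\<close>

lemma Re_limit_denom_ge:
  assumes "norm w \<le> 1 / 2"
  shows "(1 + (norm \<xi>)\<^sup>2) / 4 \<le> Re (limit_denom k \<xi> w)"
proof -
  have "\<bar>\<xi> $ k\<bar> * norm w \<le> norm \<xi> * (1 / 2)"
    using assms by (intro mult_mono) (auto simp: component_le_norm_cart)
  then have "norm (2 * of_real (\<xi> $ k) * w) \<le> norm \<xi>"
    by (simp add: norm_mult)
  moreover have "norm (w\<^sup>2) \<le> (1 / 2)\<^sup>2"
    unfolding norm_power using assms by (intro power_mono) auto
  \<comment> \<open>\<open>3 s\<^sup>2 / 4 - s + 1/3\<close> is three quarters of this square, hence nonnegative.\<close>
  moreover have "0 \<le> (norm \<xi> - 2 / 3)\<^sup>2" by simp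
  then have "norm \<xi> * (4 / 3) \<le> (norm \<xi>)\<^sup>2 + 4 / 9"
    by (simp add: power2_eq_square algebra_simps)
  ultimately show ?thesis
    using abs_Re_le_cmod[of "2 * of_real (\<xi> $ k) * w"] abs_Re_le_cmod[of "w\<^sup>2"]
    unfolding limit_denom_def by (simp add: power2_eq_square)
qed

lemma Re_limit_denom_pos:
  assumes "norm w \<le> 1 / 2"
  shows "Re (limit_denom k \<xi> w) > 0"
proof -
  have "0 < (1 + (norm \<xi>)\<^sup>2) / 4"
    by (simp add: add_pos_nonneg)
  also note Re_limit_denom_ge[OF assms]
  finally show ?thesis .
qed

section \<open>Convergence of the rescaled denominators\<close>

text \<open>
  The denominator of the rotated Poisson kernel at \<open>S\<^sup>-\<^sup>1(\<rho> \<xi>)\<close>, at the complex angle \<open>\<rho> w\<close> and divided by its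
  order of magnitude \<open>\<rho>\<^sup>2\<close>.
\<close>

definition rescaled_denom :: "'n \<Rightarrow> real^'n \<Rightarrow> real \<Rightarrow> complex \<Rightarrow> complex" where
  "rescaled_denom k \<xi> \<rho> w =
     (1 - 2 * of_real (exp (- \<rho>)) *
            (of_real (fst (stereographic_inv (\<rho> *\<^sub>R \<xi>))) * cos (of_real \<rho> * w)
             - of_real (snd (stereographic_inv (\<rho> *\<^sub>R \<xi>)) $ k) * sin (of_real \<rho> * w))
        + of_real ((exp (- \<rho>))\<^sup>2)) / of_real (\<rho>\<^sup>2)"

lemma tendsto_one_minus_exp_over: "((\<lambda>\<rho>::real. (1 - exp (- \<rho>)) / \<rho>) \<longlongrightarrow> 1) (at_right 0)"
proof -
  have "((\<lambda>\<rho>::real. 1 - exp (- \<rho>)) has_field_derivative 1) (at 0)"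
    by (auto intro!: derivative_eq_intros)
  then show ?thesis
    by (simp add: DERIV_def filterlim_at_split)
qed

text \<open>
  Writing \<open>1 - 2 r u + r\<^sup>2 = (1 - r)\<^sup>2 + 2 r (1 - u)\<close> and \<open>1 - cos(\<rho> w) = 2 sin\<^sup>2(\<rho> w / 2)\<close>, the rescaled denominator
  becomes \<open>A(\<rho>) + B(\<rho>) \<cdot> (sin(\<rho> w / 2) / (\<rho> / 2))\<^sup>2 + C(\<rho>) \<cdot> sin(\<rho> w) / \<rho>\<close>. The coefficients tend to
  \<open>1 + |\<xi>|\<^sup>2\<close>, \<open>1\<close> and \<open>2 \<xi>\<^sub>k\<close>, and the two sine quotients tend to \<open>w\<close>.
\<close>

lemma tendsto_rescaled_denom:
  "((\<lambda>(\<rho>, w). rescaled_denom k \<xi> \<rho> w) \<longlongrightarrow> limit_denom k \<xi> w) (at_right 0 \<times>\<^sub>F nhds w)"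
proof -
  let ?F = "at_right (0::real) \<times>\<^sub>F nhds w"
  define s where "s = (norm \<xi>)\<^sup>2"
  define A where "A = (\<lambda>\<rho>. ((1 - exp (- \<rho>)) / \<rho>)\<^sup>2 + 4 * exp (- \<rho>) * s / (4 + \<rho>\<^sup>2 * s))"
  define B where "B = (\<lambda>\<rho>. exp (- \<rho>) * (4 - \<rho>\<^sup>2 * s) / (4 + \<rho>\<^sup>2 * s))"
  define C where "C = (\<lambda>\<rho>. 8 * exp (- \<rho>) * \<xi> $ k / (4 + \<rho>\<^sup>2 * s))"
  let ?S = "\<lambda>\<rho> w. sin (complex_of_real \<rho> * w) / of_real \<rho>"
  have fst: "filterlim fst (at_right 0) ?F"
    by (rule filterlim_fst)
  then have pos: "\<forall>\<^sub>F p in ?F. fst p > 0" and fst0: "(fst \<longlongrightarrow> 0) ?F"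
    unfolding filterlim_at by (auto elim: eventually_mono)
  have "(A \<longlongrightarrow> 1\<^sup>2 + 4 * exp (- 0) * s / (4 + 0\<^sup>2 * s)) (at_right 0)"
    unfolding A_def by (intro tendsto_intros tendsto_one_minus_exp_over) auto
  then have A: "(A \<longlongrightarrow> 1 + s) (at_right 0)" by simp
  have "(B \<longlongrightarrow> exp (- 0) * (4 - 0\<^sup>2 * s) / (4 + 0\<^sup>2 * s)) (at_right 0)"
    unfolding B_def by (intro tendsto_intros) auto
  then have B: "(B \<longlongrightarrow> 1) (at_right 0)" by simp
  have "(C \<longlongrightarrow> 8 * exp (- 0) * \<xi> $ k / (4 + 0\<^sup>2 * s)) (at_right 0)"
    unfolding C_def by (intro tendsto_intros) auto
  then have C: "(C \<longlongrightarrow> 2 * \<xi> $ k) (at_right 0)" by simp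
  have S: "((\<lambda>p. ?S (fst p) (snd p)) \<longlongrightarrow> w) ?F"
    using tendsto_sin_scaled[of w] by (simp add: case_prod_unfold)
  have "((\<lambda>p. fst p / 2) \<longlongrightarrow> 0) ?F"
    using tendsto_divide[OF fst0 tendsto_const[of 2]] by simp
  with pos have "filterlim (\<lambda>p. fst p / 2) (at_right 0) ?F"
    unfolding filterlim_at by (auto elim: eventually_mono)
  then have "filterlim (\<lambda>p. (fst p / 2, snd p)) ?F ?F"
    by (intro filterlim_Pair filterlim_snd)
  from filterlim_compose[OF S this]
  have S2: "((\<lambda>p. ?S (fst p / 2) (snd p)) \<longlongrightarrow> w) ?F" by simp
  have lim: "((\<lambda>p. of_real (A (fst p)) + of_real (B (fst p)) * (?S (fst p / 2) (snd p))\<^sup>2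
            + of_real (C (fst p)) * ?S (fst p) (snd p))
      \<longlongrightarrow> of_real (1 + s) + of_real 1 * w\<^sup>2 + of_real (2 * \<xi> $ k) * w) ?F"
    by (intro tendsto_intros S S2 filterlim_compose[OF A fst] filterlim_compose[OF B fst]
        filterlim_compose[OF C fst])
  have val: "of_real (1 + s) + of_real 1 * w\<^sup>2 + of_real (2 * \<xi> $ k) * w = limit_denom k \<xi> w"
    by (simp add: limit_denom_def s_def)
  have eq: "of_real (A \<rho>) + of_real (B \<rho>) * (?S (\<rho> / 2) v)\<^sup>2 + of_real (C \<rho>) * ?S \<rho> v
      = rescaled_denom k \<xi> \<rho> v" if "\<rho> > 0" for \<rho> v
  proof -
    (* Abbreviating the constants keeps the final identity one between rational functions. *)
    define c where "c = complex_of_real (4 + \<rho>\<^sup>2 * s)"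
    define r where "r = complex_of_real (exp (- \<rho>))"
    define R where "R = complex_of_real \<rho>"
    define T where "T = complex_of_real s"
    define X where "X = complex_of_real (\<xi> $ k)"
    have "4 + \<rho>\<^sup>2 * s > 0" by (simp add: s_def add_pos_nonneg)
    then have c0: "c \<noteq> 0" unfolding c_def of_real_eq_0_iff by simp
    have R0: "R \<noteq> 0" using that by (simp add: R_def)
    have c: "c = 4 + R\<^sup>2 * T" by (simp add: c_def R_def T_def)
    have cos: "cos (R * v) = 1 - 2 * (sin (R / 2 * v))\<^sup>2"
      using cos_double_sin[of "R / 2 * v"] by simp
    have norm: "(norm (\<rho> *\<^sub>R \<xi>))\<^sup>2 = \<rho>\<^sup>2 * s" by (simp add: s_def power_mult_distrib)
    have "rescaled_denom k \<xi> \<rho> v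
        = (1 - 2 * r * ((4 - R\<^sup>2 * T) / c * cos (R * v) - 4 / c * R * X * sin (R * v)) + r\<^sup>2) / R\<^sup>2"
      unfolding rescaled_denom_def stereographic_inv_def norm
      by (simp add: c_def r_def R_def T_def X_def)
    also have "\<dots> = ((1 - r)\<^sup>2 + 2 * r * (1 - (4 - R\<^sup>2 * T) / c * cos (R * v) + 4 / c * R * X * sin (R * v))) / R\<^sup>2"
      by (simp add: power2_eq_square algebra_simps)
    also have "\<dots> = ((1 - r) / R)\<^sup>2 + 4 * r * T / c + r * (4 - R\<^sup>2 * T) / c * (sin (R / 2 * v) / (R / 2))\<^sup>2
        + 8 * r * X / c * (sin (R * v) / R)"
    proof -
      have E: "1 - (4 - R\<^sup>2 * T) / c * cos (R * v)
          = 2 * R\<^sup>2 * T / c + 2 * (4 - R\<^sup>2 * T) / c * (sin (R / 2 * v))\<^sup>2"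
        using c0 unfolding cos by (simp add: field_simps) (simp add: c)
      then show ?thesis
        using R0 c0 unfolding E by (simp add: field_simps power2_eq_square)
    qed
    finally show ?thesis
      by (simp add: A_def B_def C_def c_def r_def R_def T_def X_def)
  qed
  from pos have "\<forall>\<^sub>F p in ?F. of_real (A (fst p)) + of_real (B (fst p)) * (?S (fst p / 2) (snd p))\<^sup>2
            + of_real (C (fst p)) * ?S (fst p) (snd p) = (case p of (\<rho>, w) \<Rightarrow> rescaled_denom k \<xi> \<rho> w)"
    by eventually_elim (simp only: eq case_prod_unfold)
  from Lim_transform_eventually[OF lim this] show ?thesis
    unfolding val .
qed

text \<open>
  By compactness of the closed disc the positivity of the real part passes from the limit to all small \<open>\<rho>\<close>.
  Thus the powers are holomorphic and converge uniformly on the disc, and so do their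
  derivatives at the centre.
\<close>

lemma higher_deriv_rescaled_tendsto:
  fixes a :: complex
  shows "((\<lambda>\<rho>. (deriv ^^ d) (\<lambda>w. rescaled_denom k \<xi> \<rho> w powr a) 0)
      \<longlongrightarrow> (deriv ^^ d) (\<lambda>w. limit_denom k \<xi> w powr a) 0) (at_right 0)"
    and "\<forall>\<^sub>F \<rho> in at_right 0. \<forall>w\<in>cball 0 (1 / 2). Re (rescaled_denom k \<xi> \<rho> w) > 0"
    and "\<forall>\<^sub>F \<rho> in at_right 0. (\<lambda>w. rescaled_denom k \<xi> \<rho> w powr a) holomorphic_on ball 0 (1 / 2)"
proof -
  let ?K = "cball (0::complex) (1 / 2)"
  have Re: "Re (limit_denom k \<xi> w) > 0" if "w \<in> ?K" for w
    using Re_limit_denom_pos[of w k \<xi>] that by simp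
  show ev: "\<forall>\<^sub>F \<rho> in at_right 0. \<forall>w\<in>?K. Re (rescaled_denom k \<xi> \<rho> w) > 0"
  proof (rule eventually_ball_compact)
    fix w assume "w \<in> ?K"
    then show "\<forall>\<^sub>F (\<rho>, w) in at_right 0 \<times>\<^sub>F nhds w. Re (rescaled_denom k \<xi> \<rho> w) > 0"
      using order_tendstoD(1)[OF tendsto_Re[OF tendsto_rescaled_denom[of k \<xi> w]] Re]
      by (simp add: case_prod_unfold)
  qed simp
  have "\<forall>\<^sub>F \<rho> in at_right 0. \<rho> > (0::real)"
    by (rule eventually_at_right_less)
  with ev show hol: "\<forall>\<^sub>F \<rho> in at_right 0. (\<lambda>w. rescaled_denom k \<xi> \<rho> w powr a) holomorphic_on ball 0 (1 / 2)"
  proof eventually_elim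
    case (elim \<rho>)
    have "rescaled_denom k \<xi> \<rho> holomorphic_on ball 0 (1 / 2)"
      unfolding rescaled_denom_def using elim(2) by (intro holomorphic_intros) auto
    moreover have "rescaled_denom k \<xi> \<rho> w \<notin> \<real>\<^sub>\<le>\<^sub>0" if "w \<in> ball 0 (1 / 2)" for w
    proof -
      have "w \<in> cball 0 (1 / 2)" using that by simp
      then have "Re (rescaled_denom k \<xi> \<rho> w) > 0" using elim(1) by blast
      then show ?thesis by (simp add: complex_nonpos_Reals_iff)
    qed
    ultimately show ?case
      by (intro holomorphic_intros) auto
  qed
  have "uniform_limit ?K (\<lambda>\<rho> w. rescaled_denom k \<xi> \<rho> w powr a) (\<lambda>w. limit_denom k \<xi> w powr a) (at_right 0)"
  proof (rule uniform_limit_compact_joint)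
    fix w assume w: "w \<in> ?K"
    have nz: "limit_denom k \<xi> w \<notin> \<real>\<^sub>\<le>\<^sub>0"
      using Re[OF w] by (auto simp: complex_nonpos_Reals_iff)
    show "((\<lambda>(\<rho>, w). rescaled_denom k \<xi> \<rho> w powr a) \<longlongrightarrow> limit_denom k \<xi> w powr a) (at_right 0 \<times>\<^sub>F nhds w)"
      using tendsto_powr_complex[OF nz tendsto_rescaled_denom[of k \<xi> w] tendsto_const[of a]]
      by (simp add: case_prod_unfold)
    show "isCont (\<lambda>w. limit_denom k \<xi> w powr a) w"
      using nz unfolding limit_denom_def by (intro continuous_intros) auto
  qed simp
  then have "uniform_limit (ball 0 (1 / 2)) (\<lambda>\<rho> w. rescaled_denom k \<xi> \<rho> w powr a) (\<lambda>w. limit_denom k \<xi> w powr a) (at_right 0)"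
    by (rule uniform_limit_on_subset) auto
  then show "((\<lambda>\<rho>. (deriv ^^ d) (\<lambda>w. rescaled_denom k \<xi> \<rho> w powr a) 0)
      \<longlongrightarrow> (deriv ^^ d) (\<lambda>w. limit_denom k \<xi> w powr a) 0) (at_right 0)"
    by (rule higher_deriv_complex_uniform_limit[OF _ hol]) auto
qed

section \<open>Square integrability of the limit\<close>

lemma limit_powr_holomorphic:
  shows "(\<lambda>w. limit_denom k \<xi> w powr a) holomorphic_on ball 0 (1 / 2)"
  and "continuous_on (cball 0 (1 / 2)) (\<lambda>w. limit_denom k \<xi> w powr a)"
proof -
  have "limit_denom k \<xi> w \<notin> \<real>\<^sub>\<le>\<^sub>0" if "w \<in> cball 0 (1 / 2)" for w
    using Re_limit_denom_pos[of w k \<xi>] that by (auto simp: complex_nonpos_Reals_iff)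
  moreover have "limit_denom k \<xi> holomorphic_on cball 0 (1 / 2)"
    unfolding limit_denom_def by (intro holomorphic_intros)
  ultimately have hol: "(\<lambda>w. limit_denom k \<xi> w powr a) holomorphic_on cball 0 (1 / 2)"
    by (intro holomorphic_on_powr holomorphic_on_const) auto
  show "(\<lambda>w. limit_denom k \<xi> w powr a) holomorphic_on ball 0 (1 / 2)"
    by (rule holomorphic_on_subset[OF hol ball_subset_cball])
  show "continuous_on (cball 0 (1 / 2)) (\<lambda>w. limit_denom k \<xi> w powr a)"
    by (rule holomorphic_on_imp_continuous_on[OF hol])
qed

text \<open>Cauchy's estimate on the circle of radius \<open>1/2\<close>.\<close>

lemma higher_deriv_limit_bound:
  assumes "a \<ge> 0"
  shows "norm ((deriv ^^ d) (\<lambda>w. limit_denom k \<xi> w powr of_real (- a)) 0)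
    \<le> fact d * 2 ^ d * 4 powr a * (1 + (norm \<xi>)\<^sup>2) powr (- a)"
proof -
  have pos: "1 + (norm \<xi>)\<^sup>2 > 0" by (simp add: add_pos_nonneg)
  have "norm (limit_denom k \<xi> w powr of_real (- a)) \<le> ((1 + (norm \<xi>)\<^sup>2) / 4) powr (- a)"
    if "norm (0 - w) = 1 / 2" for w
  proof -
    have "(1 + (norm \<xi>)\<^sup>2) / 4 \<le> norm (limit_denom k \<xi> w)"
      using Re_limit_denom_ge[of w \<xi> k] complex_Re_le_cmod[of "limit_denom k \<xi> w"] that by simp
    then show ?thesis
      using pos assms by (simp add: norm_powr_real_powr' powr_mono2')
  qed
  from Cauchy_inequality[OF limit_powr_holomorphic(1) limit_powr_holomorphic(2) _ this]
  have "norm ((deriv ^^ d) (\<lambda>w. limit_denom k \<xi> w powr of_real (- a)) 0)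
      \<le> fact d * ((1 + (norm \<xi>)\<^sup>2) / 4) powr (- a) / (1 / 2) ^ d"
    by simp
  also have "\<dots> = fact d * 2 ^ d * 4 powr a * (1 + (norm \<xi>)\<^sup>2) powr (- a)"
    using pos by (simp add: powr_divide powr_minus power_divide field_simps)
  finally show ?thesis .
qed

text \<open>
  The second part, differentiability along the line, is what allows a further derivative to be
  taken as a limit of difference quotients.
\<close>

lemma partial_deriv_profile:
  fixes a C :: real and k :: "'n::finite"
  defines "F \<equiv> \<lambda>\<eta>::real^'n. C * (1 + (norm \<eta>)\<^sup>2) powr (- a)"
  shows "of_real ((partial_deriv k ^^ d) F \<xi>) = of_real C * (deriv ^^ d) (\<lambda>w. limit_denom k \<xi> w powr of_real (- a)) 0"
    and "(\<lambda>t. (partial_deriv k ^^ d) F (\<xi> + t *\<^sub>R axis k 1)) field_differentiable at 0"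
proof -
  let ?h = "\<lambda>t. F (\<xi> + t *\<^sub>R axis k 1)"
  have h: "of_real (?h t) = of_real C * limit_denom k \<xi> (of_real (1 * t)) powr of_real (- a)" for t
    by (simp add: F_def limit_denom_of_real powr_of_real del: of_real_add of_real_minus)
  note * = higher_deriv_real_of_holomorphic[where h = ?h and t = 0, OF limit_powr_holomorphic(1) open_ball h, of d]
  show "of_real ((partial_deriv k ^^ d) F \<xi>) = of_real C * (deriv ^^ d) (\<lambda>w. limit_denom k \<xi> w powr of_real (- a)) 0"
    using *(1) partial_deriv_iterate_line[of d k F \<xi> 0] by simp
  show "(\<lambda>t. (partial_deriv k ^^ d) F (\<xi> + t *\<^sub>R axis k 1)) field_differentiable at 0"
    unfolding partial_deriv_iterate_line using *(2) by simp
qed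

lemma partial_deriv_profile_measurable:
  "(partial_deriv k ^^ d) (\<lambda>\<eta>::real^'n. C * (1 + (norm \<eta>)\<^sup>2) powr (- a)) \<in> borel_measurable borel"
proof (induction d)
  case (Suc d)
  then show ?case
    using partial_deriv_measurable[OF Suc partial_deriv_profile(2)] by simp
qed simp

lemma partial_deriv_profile_square_integrable:
  assumes "2 * a \<ge> real CARD('n)"
  shows "square_integrable (\<lambda>\<xi>::real^'n. complex_of_real
     ((partial_deriv k ^^ d) (\<lambda>\<eta>. C * (1 + (norm \<eta>)\<^sup>2) powr (- a)) \<xi>))"
proof -
  let ?G = "(partial_deriv k ^^ d) (\<lambda>\<eta>::real^'n. C * (1 + (norm \<eta>)\<^sup>2) powr (- a))"
  define M where "M = \<bar>C\<bar> * (fact d * 2 ^ d * 4 powr a)"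
  note [measurable] = partial_deriv_profile_measurable[of d k C a]
  have "a \<ge> 0" using assms of_nat_0_le_iff[of "CARD('n)"] by linarith
  have bound: "(?G \<xi>)\<^sup>2 \<le> M\<^sup>2 * (1 + (norm \<xi>)\<^sup>2) powr (- (2 * a))" for \<xi>
  proof -
    have "\<bar>?G \<xi>\<bar> = \<bar>C\<bar> * norm ((deriv ^^ d) (\<lambda>w. limit_denom k \<xi> w powr of_real (- a)) 0)"
      using arg_cong[OF partial_deriv_profile(1)[where k = k and d = d and C = C and a = a and \<xi> = \<xi>], of norm] by (simp add: norm_mult)
    also have "\<dots> \<le> M * (1 + (norm \<xi>)\<^sup>2) powr (- a)"
      unfolding M_def mult.assoc
      using higher_deriv_limit_bound[OF \<open>a \<ge> 0\<close>, of d k \<xi>] by (intro mult_left_mono) (simp_all add: mult.assoc)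
    finally have "\<bar>?G \<xi>\<bar>\<^sup>2 \<le> (M * (1 + (norm \<xi>)\<^sup>2) powr (- a))\<^sup>2"
      by (intro power_mono) auto
    also have "\<dots> = M\<^sup>2 * (1 + (norm \<xi>)\<^sup>2) powr (- (2 * a))"
      by (simp add: power2_eq_square powr_add[symmetric] algebra_simps)
    finally show ?thesis by simp
  qed
  have "integrable lborel (\<lambda>\<xi>::real^'n. M\<^sup>2 * (1 + (norm \<xi>)\<^sup>2) powr (- (2 * a)))"
    using assms by (intro integrable_mult_right integrable_one_plus_norm_powr) simp
  then have "integrable lborel (\<lambda>\<xi>. (?G \<xi>)\<^sup>2)"
    by (rule Bochner_Integration.integrable_bound) (use bound in \<open>auto intro!: AE_I2 intro: order_trans\<close>)
  then have "integrable lebesgue (\<lambda>\<xi>. (?G \<xi>)\<^sup>2)"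
    by (subst integrable_completion) auto
  moreover have "(\<lambda>\<xi>. complex_of_real (?G \<xi>)) \<in> borel_measurable lebesgue"
    by (intro measurable_completion) simp
  ultimately show ?thesis
    by (simp add: square_integrable_def)
qed

section \<open>The Euclidean limit of the wavelets\<close>

text \<open>
  With \<open>\<Theta> = \<rho> w\<close> the kernel is \<open>K\<close> times the power \<open>-a\<close> of the rescaled denominator, where \<open>K\<close> contains
  \<open>\<rho>\<^sup>-\<^sup>n\<^sup>-\<^sup>1\<close> from extracting \<open>\<rho>\<^sup>2\<close> from the denominator. The
  chain rule factor \<open>\<rho>\<^sup>-\<^sup>d\<close> cancels the normalization \<open>\<rho>\<^sup>d\<close> of the wavelet, and one factor \<open>1 / \<rho>\<close> remains.
\<close>

lemma poisson_wavelet_rescaled: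
  fixes k :: "'n::finite" and \<xi> :: "real^'n"
  defines "a \<equiv> (real CARD('n) + 1) / 2"
  shows "\<forall>\<^sub>F \<rho> in at_right 0.
    complex_of_real (\<rho> ^ CARD('n) * poisson_wavelet k d \<rho> (stereographic_inv (\<rho> *\<^sub>R \<xi>)))
      = of_real ((1 - (exp (- \<rho>))\<^sup>2) / \<rho> / sphere_area CARD('n))
        * (deriv ^^ d) (\<lambda>w. rescaled_denom k \<xi> \<rho> w powr of_real (- a)) 0"
  using higher_deriv_rescaled_tendsto(2)[of k \<xi>]
    higher_deriv_rescaled_tendsto(3)[of k \<xi> "of_real (- a)"] eventually_at_right_less[of "0::real"]
proof eventually_elim
  case (elim \<rho>)
  define x where "x = stereographic_inv (\<rho> *\<^sub>R \<xi>)"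
  define r where "r = exp (- \<rho>)"
  define N where "N = 1 - r\<^sup>2"
  define K where "K = N / (sphere_area CARD('n) * \<rho> ^ Suc CARD('n))"
  let ?h = "\<lambda>\<Theta>. poisson_kernel r (rotation k \<Theta> x)"
  let ?q = "\<lambda>w. rescaled_denom k \<xi> \<rho> w powr of_real (- a)"
  have h: "of_real (?h \<Theta>) = of_real K * ?q (of_real (inverse \<rho> * \<Theta>))"
    if \<Theta>: "complex_of_real (inverse \<rho> * \<Theta>) \<in> ball 0 (1 / 2)" for \<Theta>
  proof -
    define D where "D = 1 - 2 * r * fst (rotation k \<Theta> x) + r\<^sup>2"
    have \<rho>\<Theta>: "complex_of_real \<rho> * of_real (inverse \<rho> * \<Theta>) = of_real \<Theta>"
      using elim(3) by simp
    have q: "rescaled_denom k \<xi> \<rho> (of_real (inverse \<rho> * \<Theta>)) = of_real (D / \<rho>\<^sup>2)"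
      unfolding rescaled_denom_def \<rho>\<Theta> x_def[symmetric] r_def[symmetric]
      by (simp add: D_def rotation_def cos_of_real sin_of_real)
    then have "D / \<rho>\<^sup>2 > 0"
      using elim(1) \<Theta> by (metis Re_complex_of_real ball_subset_cball subsetD)
    then have "D > 0" using elim(3) by (simp add: zero_less_divide_iff)
    \<comment> \<open>The exponent \<open>2 a\<close> is the integer \<open>n + 1\<close>, so the extracted factor is an ordinary power of \<open>\<rho>\<close>.\<close>
    have "\<rho>\<^sup>2 powr a = \<rho> powr (2 * a)"
      using elim(3) by (simp add: powr_powr flip: powr_numeral)
    also have "2 * a = real (Suc CARD('n))" by (simp add: a_def)
    also have "\<rho> powr \<dots> = \<rho> ^ Suc CARD('n)"
      using elim(3) by (rule powr_realpow)
    finally have "(D / \<rho>\<^sup>2) powr (- a) = \<rho> ^ Suc CARD('n) / D powr a"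
      using \<open>D > 0\<close> elim(3) by (simp add: powr_minus powr_divide)
    then have "?h \<Theta> = K * (D / \<rho>\<^sup>2) powr (- a)"
      using elim(3) by (simp add: poisson_kernel_def K_def N_def D_def a_def)
    then show ?thesis
      unfolding q using \<open>D / \<rho>\<^sup>2 > 0\<close> powr_of_real[of "D / \<rho>\<^sup>2" "- a"] by simp
  qed
  have deriv: "of_real ((deriv ^^ d) ?h 0) = of_real K * of_real (inverse \<rho>) ^ d * (deriv ^^ d) ?q 0"
    using higher_deriv_real_of_holomorphic(1)[where h = ?h and t = 0, OF elim(2) open_ball h, of d] by simp
  have const: "\<rho> ^ CARD('n) * \<rho> ^ d * (K * inverse \<rho> ^ d) = N / \<rho> / sphere_area CARD('n)"
    using elim(3) by (simp add: K_def field_simps)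
  have "of_real (\<rho> ^ CARD('n) * (\<rho> ^ d * (deriv ^^ d) ?h 0))
      = of_real (\<rho> ^ CARD('n) * \<rho> ^ d * (K * inverse \<rho> ^ d)) * (deriv ^^ d) ?q 0"
    unfolding of_real_mult deriv by (simp only: of_real_power mult.assoc)
  then show ?case
    by (simp only: const poisson_wavelet_def x_def r_def N_def)
qed

theorem theorem6p1:
  fixes k :: "'n::finite" and n d :: nat and lam :: real
  assumes "n = CARD('n)" and "n \<ge> 2" and "lam = (real n - 1) / 2"
  shows "has_euclidean_limit
    (\<lambda>\<rho> x. complex_of_real (poisson_wavelet k d \<rho> x))
    (\<lambda>\<xi>. complex_of_real
       ((partial_deriv k ^^ d)
          (\<lambda>\<eta>. 2 / (sphere_area n * (1 + (norm \<eta>)\<^sup>2) powr (lam + 1))) \<xi>))"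
proof -
  define a where "a = (real CARD('n) + 1) / 2"
  define C where "C = 2 / sphere_area CARD('n)"
  have lam: "lam + 1 = a"
    using assms by (simp add: a_def field_simps)
  have profile: "(\<lambda>\<eta>::real^'n. 2 / (sphere_area n * (1 + (norm \<eta>)\<^sup>2) powr (lam + 1)))
      = (\<lambda>\<eta>. C * (1 + (norm \<eta>)\<^sup>2) powr (- a))"
    unfolding lam C_def assms(1) by (simp add: powr_minus divide_inverse mult.assoc)
  \<comment> \<open>The factor \<open>2\<close> in \<open>C\<close> is the value of \<open>1 + r\<close> at \<open>\<rho> = 0\<close>, from \<open>1 - r\<^sup>2 = (1 - r) (1 + r)\<close>.\<close>
  have pre: "((\<lambda>\<rho>. (1 - (exp (- \<rho>))\<^sup>2) / \<rho> / sphere_area CARD('n)) \<longlongrightarrow> C) (at_right 0)"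
  proof -
    have "((\<lambda>\<rho>::real. (1 - exp (- \<rho>)) / \<rho> * (1 + exp (- \<rho>)) / sphere_area CARD('n))
        \<longlongrightarrow> 1 * (1 + exp (- 0)) * inverse (sphere_area CARD('n))) (at_right 0)"
      unfolding divide_inverse[of _ "sphere_area _"]
      by (intro tendsto_intros tendsto_one_minus_exp_over)
    then show ?thesis
      by (simp add: C_def divide_inverse power2_eq_square algebra_simps)
  qed
  show ?thesis
    unfolding has_euclidean_limit_def profile
  proof (intro conjI allI)
    show "square_integrable (\<lambda>\<xi>. complex_of_real ((partial_deriv k ^^ d) (\<lambda>\<eta>. C * (1 + (norm \<eta>)\<^sup>2) powr (- a)) \<xi>))"
      by (rule partial_deriv_profile_square_integrable) (simp add: a_def)
    fix \<xi> :: "real^'n"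
    have "((\<lambda>\<rho>. of_real ((1 - (exp (- \<rho>))\<^sup>2) / \<rho> / sphere_area CARD('n))
            * (deriv ^^ d) (\<lambda>w. rescaled_denom k \<xi> \<rho> w powr of_real (- a)) 0)
        \<longlongrightarrow> of_real C * (deriv ^^ d) (\<lambda>w. limit_denom k \<xi> w powr of_real (- a)) 0) (at_right 0)"
      by (intro tendsto_mult tendsto_of_real pre higher_deriv_rescaled_tendsto(1))
    then have "((\<lambda>\<rho>. complex_of_real (\<rho> ^ CARD('n) * poisson_wavelet k d \<rho> (stereographic_inv (\<rho> *\<^sub>R \<xi>))))
        \<longlongrightarrow> of_real C * (deriv ^^ d) (\<lambda>w. limit_denom k \<xi> w powr of_real (- a)) 0) (at_right 0)"
      by (rule Lim_transform_eventually)
         (use poisson_wavelet_rescaled[of k d \<xi>] in \<open>auto elim!: eventually_mono simp: a_def\<close>)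
    then show "((\<lambda>\<rho>. of_real (\<rho> ^ CARD('n)) * complex_of_real (poisson_wavelet k d \<rho> (stereographic_inv (\<rho> *\<^sub>R \<xi>))))
        \<longlongrightarrow> of_real ((partial_deriv k ^^ d) (\<lambda>\<eta>. C * (1 + (norm \<eta>)\<^sup>2) powr (- a)) \<xi>)) (at_right 0)"
      by (simp only: partial_deriv_profile(1) of_real_mult)
  qed
qed

end
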